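(* Let $\ell>1$ be an integer and let $\Gamma$ be a nonempty graph that is strongly $\ell$-walk-regular with parameters $(\lambda_\ell,0,\nu_\ell)$ (i.e. with $\mu_\ell=0$). Then either $\Gamma$ is a disjoint union of complete graphs of the same order, or $\ell$ is odd and $\Gamma$ is a disjoint union of complete bipartite graphs of the same size and (possibly zero) isolated vertices.
   Context: Graphs are finite, simple and undirected; a graph is nonempty if it has at least one edge. For an integer $\ell>1$, a graph $\Gamma$ is strongly $\ell$-walk-regular with parameters $(\lambda_\ell,\mu_\ell,\nu_\ell)$ if the number of walks of length $\ell$ between two vertices is $\lambda_\ell$ for every two adjacent vertices, $\mu_\ell$ for every two distinct non-adjacent vertices, and $\nu_\ell$ for every two identical vertices (i.e. from each vertex to itself). If there are no pairs of some type, the corresponding condition is vacuous. "Order" means number of vertices, and "size" means number of edges, so the complete bipartite graphs all have the same number of edges (their bipartition sizes may differ). A disjoint union may have a single component. "Either ... or" is meant inclusively. *)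

theory Defs
  imports "Graph_Theory.Graph_Theory"
begin

text \<open>
  Finite simple undirected graphs are rendered by the locale \<open>graph\<close>: finite symmetric loopless
  digraphs without parallel arcs. Each undirected edge is thus a pair of opposite arcs, and is
  counted only once in \<open>num_edges\<close>.
\<close>

definition undirected_edges :: "('a, 'b) pre_digraph \<Rightarrow> 'a set set" where
  "undirected_edges G = {{u, v} | u v. (u, v) \<in> arcs_ends G}"

definition num_edges :: "('a, 'b) pre_digraph \<Rightarrow> nat" where
  "num_edges G = card (undirected_edges G)"

text \<open>
  A walk is a list of consecutive arcs, so its length is the length of the list. In the absence of
  parallel arcs, such lists (with their starting vertex) correspond one-to-one to sequences of
  consecutively adjacent vertices.
\<close>

definition num_walks :: "('a, 'b) pre_digraph \<Rightarrow> nat \<Rightarrow> 'a \<Rightarrow> 'a \<Rightarrow> nat" where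
  "num_walks G l u v = card {p. pre_digraph.awalk G u p v \<and> length p = l}"

definition strongly_walk_regular ::
    "nat \<Rightarrow> nat \<Rightarrow> nat \<Rightarrow> nat \<Rightarrow> ('a, 'b) pre_digraph \<Rightarrow> bool" where
  "strongly_walk_regular l lam mu nu G \<longleftrightarrow>
     (\<forall>u \<in> verts G. \<forall>v \<in> verts G. (u, v) \<in> arcs_ends G \<longrightarrow> num_walks G l u v = lam) \<and>
     (\<forall>u \<in> verts G. \<forall>v \<in> verts G. u \<noteq> v \<and> (u, v) \<notin> arcs_ends G \<longrightarrow> num_walks G l u v = mu) \<and>
     (\<forall>u \<in> verts G. num_walks G l u u = nu)"

text \<open>
  Internal disjoint union: the members of \<open>F\<close> have the same head and tail maps as \<open>G\<close> and
  pairwise disjoint vertex sets, and their union is \<open>G\<close>.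
\<close>

definition disjoint_union_of :: "('a, 'b) pre_digraph \<Rightarrow> ('a, 'b) pre_digraph set \<Rightarrow> bool" where
  "disjoint_union_of G F \<longleftrightarrow>
     (\<forall>H \<in> F. compatible G H) \<and>
     pairwise (\<lambda>H H'. disjnt (verts H) (verts H')) F \<and>
     G = pre_digraph.Union G F"

definition is_complete_graph :: "('a, 'b) pre_digraph \<Rightarrow> bool" where
  "is_complete_graph G \<longleftrightarrow> (\<exists>n \<ge> 1. complete_digraph n G)"

text \<open>Both colour classes are required to be nonempty.\<close>

definition is_complete_bipartite_graph :: "('a, 'b) pre_digraph \<Rightarrow> bool" where
  "is_complete_bipartite_graph G \<longleftrightarrow> (\<exists>m \<ge> 1. \<exists>n \<ge> 1. complete_bipartite_digraph m n G)"

definition disjoint_union_of_complete_graphs_same_order :: "('a, 'b) pre_digraph \<Rightarrow> bool" where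
  "disjoint_union_of_complete_graphs_same_order G \<longleftrightarrow>
     (\<exists>F. disjoint_union_of G F \<and> (\<forall>H \<in> F. is_complete_graph H) \<and>
        (\<forall>H \<in> F. \<forall>H' \<in> F. card (verts H) = card (verts H')))"

text \<open>An isolated vertex is a component \<open>K\<^sub>1\<close>; \<open>I\<close> may be empty.\<close>

definition disjoint_union_of_complete_bipartite_graphs_same_size_and_isolated_vertices ::
    "('a, 'b) pre_digraph \<Rightarrow> bool" where
  "disjoint_union_of_complete_bipartite_graphs_same_size_and_isolated_vertices G \<longleftrightarrow>
     (\<exists>F I. disjoint_union_of G (F \<union> I) \<and> (\<forall>H \<in> F. is_complete_bipartite_graph H) \<and>
        (\<forall>H \<in> F. \<forall>H' \<in> F. num_edges H = num_edges H') \<and>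
        (\<forall>H \<in> I. complete_digraph 1 H))"

end

theory Submission
  imports Defs
begin

text \<open>
  Since \<open>mu = 0\<close>, the ends of every walk of length \<open>l\<close> are equal or adjacent, and walks may be
  lengthened by 2 by going back and forth along an edge. If \<open>l\<close> is even, adjacency is therefore
  transitive on distinct vertices and the components are complete. If \<open>l\<close> is odd, the distinct ends
  of walks of length 3 are adjacent. Then a triangle forces \<open>nu > 0\<close>, hence closed walks of odd
  length at every vertex, hence a triangle at every vertex, which again makes adjacency transitive;
  without triangles the components are isolated vertices and complete bipartite graphs, and the
  number of edges \<open>m n\<close> of each of the latter is determined by \<open>lam = (m n) ^ ((l - 1) / 2)\<close>.
  In the complete case, counting all walks of length \<open>l\<close> from a vertex of degree \<open>d\<close> gives
  \<open>d ^ l = nu + d * lam\<close>, which determines \<open>d\<close> because \<open>nu > 0\<close>.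
\<close>

unbundle no funcset_syntax

abbreviation (in pre_digraph) neighborhood :: "'a \<Rightarrow> 'a set" where
  "neighborhood u \<equiv> arcs_ends G `` {u}"

section \<open>Counting walks\<close>

context graph
begin

lemma adj_sym: "u \<rightarrow> v \<Longrightarrow> v \<rightarrow> u"
  using arcs_ends_symmetric[OF sym_arcs] .

lemma neighborhood_subset_verts: "neighborhood u \<subseteq> verts G"
  using adj_in_verts by blast

lemma finite_neighborhood [simp]: "finite (neighborhood u)"
  using neighborhood_subset_verts finite_verts by (rule finite_subset)

lemma not_in_own_neighborhood: "u \<notin> neighborhood u"
  using adj_not_same by blast

lemma card_neighborhood_pos_iff: "0 < card (neighborhood u) \<longleftrightarrow> (\<exists>v. u \<rightarrow> v)"
  by (auto simp: card_gt_0_iff)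

lemma finite_walks: "finite {p. awalk u p v \<and> length p = k}"
  by (rule finite_subset[OF _ finite_lists_length_eq[OF finite_arcs, of k]]) (auto simp: awalk_def)

lemma num_walks_0: "u \<in> verts G \<Longrightarrow> num_walks G 0 u v = (if u = v then 1 else 0)"
proof -
  assume "u \<in> verts G"
  then have "{p. awalk u p v \<and> length p = 0} = (if u = v then {[]} else {})"
    by (auto simp: awalk_Nil_iff)
  then show ?thesis by (simp add: num_walks_def)
qed

text \<open>Walks are split by their first arc. As there are no parallel arcs, \<open>head G\<close>
  maps the out-arcs of \<open>u\<close> bijectively onto its neighbours, which turns the sum over
  arcs into one over vertices.\<close>

lemma num_walks_Suc: "num_walks G (Suc k) u v = (\<Sum>w\<in>neighborhood u. num_walks G k w v)"
proof -
  let ?W = "\<lambda>k u. {p. awalk u p v \<and> length p = k}"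
  have "?W (Suc k) u = (\<Union>e\<in>out_arcs G u. (#) e ` ?W k (head G e))"
  proof (intro equalityI subsetI)
    fix p assume p: "p \<in> ?W (Suc k) u"
    then obtain e q where "p = e # q" by (cases p) auto
    with p show "p \<in> (\<Union>e\<in>out_arcs G u. (#) e ` ?W k (head G e))"
      by (auto simp: awalk_Cons_iff)
  qed (auto simp: awalk_Cons_iff)
  then have "card (?W (Suc k) u) = (\<Sum>e\<in>out_arcs G u. card ((#) e ` ?W k (head G e)))"
    by (simp only:) (rule card_UN_disjoint; auto simp: finite_walks)
  also have "\<dots> = (\<Sum>e\<in>out_arcs G u. card (?W k (head G e)))"
    by (simp add: card_image)
  also have "\<dots> = (\<Sum>w\<in>neighborhood u. card (?W k w))"
  proof (rule sum.reindex_bij_betw)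
    show "bij_betw (head G) (out_arcs G u) (neighborhood u)"
      unfolding bij_betw_def
    proof
      show "inj_on (head G) (out_arcs G u)"
        by (auto intro!: inj_onI no_multi_arcs simp: arc_to_ends_def)
      show "head G ` out_arcs G u = neighborhood u"
        by (auto simp: arcs_ends_conv image_iff)
    qed
  qed
  finally show ?thesis by (simp add: num_walks_def)
qed

lemma num_walks_1: "u \<rightarrow> v \<Longrightarrow> num_walks G 1 u v = 1"
proof -
  assume "u \<rightarrow> v"
  have "num_walks G 1 u v = (\<Sum>w\<in>neighborhood u. if w = v then 1 else 0)"
    unfolding One_nat_def num_walks_Suc
    by (rule sum.cong) (auto simp: num_walks_0 adj_in_verts)
  then show ?thesis using \<open>u \<rightarrow> v\<close> by (simp add: sum.delta)
qed

lemma num_walks_Suc_pos_iff: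
  "0 < num_walks G (Suc k) u v \<longleftrightarrow> (\<exists>w. u \<rightarrow> w \<and> 0 < num_walks G k w v)"
  by (auto simp: num_walks_Suc simp flip: neq0_conv)

text \<open>A walk from \<open>u\<close> may be preceded by \<open>j\<close> round trips from
  \<open>u\<close> to \<open>w\<close> and back.\<close>

lemma num_walks_add_even_pos:
  assumes "u \<rightarrow> w" "0 < num_walks G k u v"
  shows "0 < num_walks G (2 * j + k) u v"
proof (induction j)
  case (Suc j)
  then have "0 < num_walks G (Suc (Suc (2 * j + k))) u v"
    using assms(1) adj_sym num_walks_Suc_pos_iff by blast
  then show ?case by simp
qed (simp add: assms)

lemma num_walks_even_pos:
  assumes "even l" "2 \<le> l" "u \<rightarrow> a" "a \<rightarrow> v"
  shows "0 < num_walks G l u v"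
proof -
  obtain j where "l = 2 * j + 2"
    using assms(1,2) by (metis add.commute dvdE dvd_diff_nat dvd_refl le_add_diff_inverse)
  moreover have "0 < num_walks G 2 u v"
    unfolding numeral_2_eq_2 num_walks_Suc_pos_iff
    using assms(3,4) num_walks_0[of v v] adj_in_verts(2)[OF assms(4)] by (metis zero_less_one)
  ultimately show ?thesis
    using num_walks_add_even_pos[OF assms(3), of 2 v j] by simp
qed

lemma num_walks_odd_pos:
  assumes "odd l" "3 \<le> l" "u \<rightarrow> a" "a \<rightarrow> b" "b \<rightarrow> v"
  shows "0 < num_walks G l u v"
proof -
  \<comment> \<open>One step to \<open>a\<close> leaves an even length, covered by the walk through
    \<open>b\<close>.\<close>
  have "even (l - 1)" "2 \<le> l - 1" "l = Suc (l - 1)"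
    using assms(1,2) by auto
  then show ?thesis
    using num_walks_even_pos[OF _ _ assms(4,5), of "l - 1"] assms(3) num_walks_Suc_pos_iff by metis
qed

text \<open>Equal degrees along arcs make the degree constant on each component, so every step of a
  walk has the same number of choices.\<close>

lemma sum_num_walks_regular:
  assumes reg: "\<And>u v. u \<rightarrow> v \<Longrightarrow> card (neighborhood u) = card (neighborhood v)"
    and "u \<in> verts G"
  shows "(\<Sum>v\<in>verts G. num_walks G k u v) = card (neighborhood u) ^ k"
  using assms(2)
proof (induction k arbitrary: u)
  case 0
  then show ?case by (simp add: num_walks_0)
next
  case (Suc k)
  have "(\<Sum>v\<in>verts G. num_walks G (Suc k) u v) =
      (\<Sum>w\<in>neighborhood u. \<Sum>v\<in>verts G. num_walks G k w v)"
    unfolding num_walks_Suc by (rule sum.swap)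
  also have "\<dots> = (\<Sum>w\<in>neighborhood u. card (neighborhood u) ^ k)"
    by (rule sum.cong) (auto simp: Suc.IH adj_in_verts reg[symmetric])
  finally show ?case by simp
qed

section \<open>Decomposition into components\<close>

lemma graph_induce_subgraph: "S \<subseteq> verts G \<Longrightarrow> graph (G \<restriction> S)"
proof -
  assume S: "S \<subseteq> verts G"
  interpret H: wf_digraph "G \<restriction> S" by (rule wellformed_induce_subgraph)
  show ?thesis
  proof
    show "symmetric (G \<restriction> S)"
      by (rule induced_graph_imp_symmetric[OF sym_arcs induced_induce[OF S]])
  qed (use finite_subset[OF S finite_verts] in \<open>auto dest: no_loops no_multi_arcs\<close>)
qed

lemma arcs_ends_induce_subgraph: "arcs_ends (G \<restriction> S) = arcs_ends G \<inter> S \<times> S"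
  by (auto simp: arcs_ends_conv)

text \<open>No arc leaves the class of its tail, so the subgraphs induced on the classes together
  contain all arcs.\<close>

lemma disjoint_union_of_quotient:
  assumes E: "equiv (verts G) E" and adj: "arcs_ends G \<subseteq> E"
  shows "disjoint_union_of G ((\<restriction>) G ` (verts G // E))"
  unfolding disjoint_union_of_def
proof (intro conjI ballI)
  fix H assume "H \<in> (\<restriction>) G ` (verts G // E)"
  then show "compatible G H" by (auto simp: compatible_def)
next
  show "pairwise (\<lambda>H H'. disjnt (verts H) (verts H')) ((\<restriction>) G ` (verts G // E))"
    using quotient_disj[OF E] by (fastforce simp: pairwise_def disjnt_def)
next
  have "\<exists>C\<in>verts G // E. e \<in> arcs (G \<restriction> C)" if "e \<in> arcs G" for e
  proof
    show "E `` {tail G e} \<in> verts G // E" using that by (intro quotientI) simp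
    have "(tail G e, head G e) \<in> E" using that adj by (auto simp: arcs_ends_conv)
    then show "e \<in> arcs (G \<restriction> E `` {tail G e})"
      using that equiv_class_self[OF E] by simp
  qed
  then have "(\<Union>C\<in>verts G // E. arcs (G \<restriction> C)) = arcs G" by auto
  then show "G = Union ((\<restriction>) G ` (verts G // E))"
    by (simp add: Union_def Union_quotient[OF E])
qed

text \<open>Adjacency or equality is an equivalence here, and its classes are the closed
  neighbourhoods.\<close>

lemma disjoint_union_complete_graphs:
  assumes trans: "\<And>u v w. u \<rightarrow> v \<Longrightarrow> v \<rightarrow> w \<Longrightarrow> u \<noteq> w \<Longrightarrow> u \<rightarrow> w"
    and deg: "\<And>u. u \<in> verts G \<Longrightarrow> card (neighborhood u) = d"
  shows "disjoint_union_of_complete_graphs_same_order G"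
proof -
  define E where "E = {(u, v). u \<in> verts G \<and> v \<in> verts G \<and> (u = v \<or> u \<rightarrow> v)}"
  have E: "equiv (verts G) E"
  proof (rule equivI)
    show "E \<subseteq> verts G \<times> verts G" "refl_on (verts G) E"
      using adj_in_verts by (auto simp: E_def refl_on_def)
    show "sym E" using adj_sym by (auto simp: E_def sym_def)
    show "trans E" unfolding E_def trans_def using trans by blast
  qed
  have adj: "arcs_ends G \<subseteq> E" using adj_in_verts by (auto simp: E_def)
  have comp: "complete_digraph (Suc d) (G \<restriction> C)" if "C \<in> verts G // E" for C
  proof -
    obtain u where u: "u \<in> verts G" "C = E `` {u}"
      using \<open>C \<in> verts G // E\<close> by (rule quotientE)
    then have C: "C = insert u (neighborhood u)"
      using adj_in_verts unfolding E_def by blast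
    have "card C = Suc d"
      unfolding C using deg[OF u(1)] not_in_own_neighborhood by (subst card_insert_disjoint) auto
    moreover have "arcs_ends G \<inter> C \<times> C = {(v, w). (v, w) \<in> C \<times> C \<and> v \<noteq> w}"
      using trans adj_sym adj_not_same unfolding C by blast
    moreover have "C \<subseteq> verts G" using C u(1) neighborhood_subset_verts by blast
    ultimately show ?thesis
      unfolding complete_digraph_def arcs_ends_induce_subgraph
      using graph_induce_subgraph by simp
  qed
  show ?thesis
    unfolding disjoint_union_of_complete_graphs_same_order_def is_complete_graph_def
  proof (intro exI[of _ "(\<restriction>) G ` (verts G // E)"] conjI ballI)
    show "disjoint_union_of G ((\<restriction>) G ` (verts G // E))"
      using E adj by (rule disjoint_union_of_quotient)
  next
    fix H assume "H \<in> (\<restriction>) G ` (verts G // E)"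
    with comp have "complete_digraph (Suc d) H" by blast
    then show "\<exists>n\<ge>1. complete_digraph n H" by (intro exI[of _ "Suc d"]) simp
  next
    fix H H' assume "H \<in> (\<restriction>) G ` (verts G // E)" "H' \<in> (\<restriction>) G ` (verts G // E)"
    with comp show "card (verts H) = card (verts H')" by (auto simp: complete_digraph_def)
  qed
qed

text \<open>For a neighbour w of \<open>u\<close>, the walk w, u, a, v shortens to an arc; the
  converse is symmetric.\<close>

lemma neighborhood_eq_of_common_neighbor:
  assumes closed: "\<forall>u a b v. u \<rightarrow> a \<and> a \<rightarrow> b \<and> b \<rightarrow> v \<longrightarrow> u \<rightarrow> v"
    and "u \<rightarrow> a" "a \<rightarrow> v"
  shows "neighborhood u = neighborhood v"
  using assms adj_sym by blast

lemma disjoint_union_complete_bipartite_graphs: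
  assumes closed: "\<forall>u a b v. u \<rightarrow> a \<and> a \<rightarrow> b \<and> b \<rightarrow> v \<longrightarrow> u \<rightarrow> v"
    and size: "\<And>u v. u \<rightarrow> v \<Longrightarrow> card (neighborhood u) * card (neighborhood v) = c"
  shows "disjoint_union_of_complete_bipartite_graphs_same_size_and_isolated_vertices G"
proof -
  \<comment> \<open>Walks of length 3 shorten to arcs, so being joined by a walk of length at most 2
    is already transitive.\<close>
  define E where "E = {(u, v). u \<in> verts G \<and> v \<in> verts G \<and>
    (u = v \<or> u \<rightarrow> v \<or> (\<exists>a. u \<rightarrow> a \<and> a \<rightarrow> v))}"
  have E: "equiv (verts G) E"
  proof (rule equivI)
    show "E \<subseteq> verts G \<times> verts G" "refl_on (verts G) E"
      using adj_in_verts by (auto simp: E_def refl_on_def)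
    show "sym E" unfolding E_def sym_def using adj_sym by blast
    show "trans E" unfolding E_def trans_def using closed by blast
  qed
  have adj: "arcs_ends G \<subseteq> E" using adj_in_verts by (auto simp: E_def)
  define F where "F = {G \<restriction> E `` {u} | u v. u \<rightarrow> v}"
  define I where "I = {G \<restriction> E `` {u} | u. u \<in> verts G \<and> \<not> (\<exists>v. u \<rightarrow> v)}"
  have "F \<union> I = (\<restriction>) G ` (verts G // E)"
    using adj_in_verts unfolding F_def I_def quotient_def by blast
  then have "disjoint_union_of G (F \<union> I)"
    using disjoint_union_of_quotient[OF E adj] by simp
  moreover have "is_complete_bipartite_graph H \<and> num_edges H = c" if "H \<in> F" for H
  proof -
    from that obtain u v where uv: "u \<rightarrow> v" and H: "H = G \<restriction> E `` {u}"
      unfolding F_def by blast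
    \<comment> \<open>The colour class of each end of the edge is the neighbourhood of the other
      end.\<close>
    let ?U = "neighborhood v" and ?V = "neighborhood u"
    have C: "E `` {u} = ?U \<union> ?V"
      using uv adj_sym closed adj_in_verts unfolding E_def by blast
    \<comment> \<open>A common neighbour w would give the walk u, v, w, u, which
      \<open>closed\<close> would shorten to a loop.\<close>
    have disj: "?U \<inter> ?V = {}"
      using uv closed adj_sym adj_not_same by blast
    have ends: "arcs_ends H = ?U \<times> ?V \<union> ?V \<times> ?U"
      unfolding H C arcs_ends_induce_subgraph using uv closed adj_sym adj_not_same by blast
    have "graph H"
      unfolding H C using neighborhood_subset_verts by (intro graph_induce_subgraph) blast
    then have "complete_bipartite_digraph (card ?U) (card ?V) H"
      unfolding complete_bipartite_digraph_def using C H disj ends by (metis induce_subgraph_verts)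
    moreover have "0 < card ?U" "0 < card ?V"
      using uv adj_sym card_neighborhood_pos_iff by blast+
    ultimately have "is_complete_bipartite_graph H"
      unfolding is_complete_bipartite_graph_def by (metis One_nat_def Suc_leI)
    moreover have "undirected_edges H = (\<lambda>(x, y). {x, y}) ` (?U \<times> ?V)"
      unfolding undirected_edges_def ends by (auto simp: insert_commute image_iff)
    moreover have "inj_on (\<lambda>(x, y). {x, y}) (?U \<times> ?V)"
      using disj by (auto simp: inj_on_def doubleton_eq_iff)
    ultimately show ?thesis
      using size[OF uv] by (simp add: num_edges_def card_image card_cartesian_product mult.commute)
  qed
  moreover have "complete_digraph 1 H" if "H \<in> I" for H
  proof -
    from that obtain u where u: "u \<in> verts G" "\<not> (\<exists>v. u \<rightarrow> v)" and H: "H = G \<restriction> E `` {u}"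
      unfolding I_def by blast
    have C: "E `` {u} = {u}" using u by (auto simp: E_def)
    have "arcs_ends H = {}" using u(2) unfolding H C arcs_ends_induce_subgraph by blast
    moreover have "graph H" unfolding H C using u(1) by (intro graph_induce_subgraph) simp
    ultimately show ?thesis unfolding complete_digraph_def H C by auto
  qed
  ultimately show ?thesis
    unfolding disjoint_union_of_complete_bipartite_graphs_same_size_and_isolated_vertices_def
    by metis
qed

section \<open>Walks of odd length\<close>

text \<open>Walks alternate between the two colour classes, so two further steps multiply the count
  by the product of the class sizes.\<close>

lemma num_walks_odd_complete_bipartite:
  assumes closed: "\<forall>u a b v. u \<rightarrow> a \<and> a \<rightarrow> b \<and> b \<rightarrow> v \<longrightarrow> u \<rightarrow> v"
    and "u \<rightarrow> v"
  shows "num_walks G (2 * j + 1) u v = (card (neighborhood u) * card (neighborhood v)) ^ j"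
  using assms(2)
proof (induction j arbitrary: u)
  case 0
  then show ?case using num_walks_1 by simp
next
  case (Suc j)
  let ?d = "card (neighborhood u) * card (neighborhood v)"
  have "num_walks G (2 * Suc j + 1) u v =
      (\<Sum>a\<in>neighborhood u. \<Sum>b\<in>neighborhood a. num_walks G (2 * j + 1) b v)"
    by (simp add: num_walks_Suc)
  also have "\<dots> = (\<Sum>a\<in>neighborhood u. \<Sum>b\<in>neighborhood v. ?d ^ j)"
  proof (intro sum.cong)
    \<comment> \<open>Both \<open>a\<close> and \<open>v\<close> are adjacent to \<open>u\<close>,
      and both \<open>b\<close> and \<open>u\<close> are adjacent to \<open>v\<close>; so the
      degrees repeat and the induction hypothesis at \<open>b\<close> has the same base.\<close>
    fix a assume "a \<in> neighborhood u"
    then have a: "u \<rightarrow> a" by simp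
    then show "neighborhood a = neighborhood v"
      using neighborhood_eq_of_common_neighbor[OF closed] adj_sym Suc.prems by blast
    fix b assume "b \<in> neighborhood v"
    then have b: "b \<rightarrow> v" using adj_sym by blast
    moreover have "neighborhood b = neighborhood u"
      using neighborhood_eq_of_common_neighbor[OF closed] b adj_sym Suc.prems by blast
    ultimately show "num_walks G (2 * j + 1) b v = ?d ^ j"
      using Suc.IH by simp
  qed simp
  finally show ?case by (simp add: mult.assoc)
qed

text \<open>By induction the walk shortens to v, b, a, u, and then to an arc unless
  \<open>v = u\<close>, which would be a triangle at \<open>u\<close>. For \<open>v = u\<close> the
  conclusion is a loop, so a vertex in no triangle has no closed walk of odd length.\<close>

lemma odd_walk_to_triangle_free_vertex:
  assumes closed: "\<forall>u a b v. u \<rightarrow> a \<and> a \<rightarrow> b \<and> b \<rightarrow> v \<and> u \<noteq> v \<longrightarrow> u \<rightarrow> v"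
    and no_triangle: "\<not> (\<exists>a b. u \<rightarrow> a \<and> a \<rightarrow> b \<and> b \<rightarrow> u)"
    and "v \<in> verts G" "0 < num_walks G (2 * j + 1) v u"
  shows "v \<rightarrow> u"
  using assms(3,4)
proof (induction j arbitrary: v)
  case 0
  then show ?case
    by (auto simp: num_walks_Suc_pos_iff num_walks_0 adj_in_verts split: if_splits)
next
  case (Suc j)
  then obtain b a where "v \<rightarrow> b" "b \<rightarrow> a" "0 < num_walks G (2 * j + 1) a u"
    by (auto simp: num_walks_Suc_pos_iff)
  moreover from this have "a \<rightarrow> u" using Suc.IH adj_in_verts by blast
  ultimately show ?case using closed no_triangle by blast
qed

text \<open>If \<open>u\<close> differs from \<open>b\<close>, the walk u, v, c, b gives an arc from
  \<open>u\<close> to \<open>b\<close>, and then u, b, v, w gives the claim. Otherwise b, c, v, w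
  does.\<close>

lemma adj_trans_of_triangles:
  assumes closed: "\<forall>u a b v. u \<rightarrow> a \<and> a \<rightarrow> b \<and> b \<rightarrow> v \<and> u \<noteq> v \<longrightarrow> u \<rightarrow> v"
    and triangle: "v \<rightarrow> b" "b \<rightarrow> c" "c \<rightarrow> v"
    and uw: "u \<rightarrow> v" "v \<rightarrow> w" "u \<noteq> w"
  shows "u \<rightarrow> w"
proof (cases "u = b")
  case True
  then show ?thesis using closed triangle uw by blast
next
  case False
  then have "u \<rightarrow> b" using closed triangle uw adj_sym by blast
  then show ?thesis using closed triangle uw adj_sym by blast
qed

section \<open>Strongly walk-regular graphs with no walks between non-adjacent vertices\<close>

lemma walk_regular_complete_graphs:
  assumes swr: "strongly_walk_regular l lam 0 nu G" and "1 < l" "0 < nu"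
    and trans: "\<And>u v w. u \<rightarrow> v \<Longrightarrow> v \<rightarrow> w \<Longrightarrow> u \<noteq> w \<Longrightarrow> u \<rightarrow> w"
  shows "disjoint_union_of_complete_graphs_same_order G"
proof -
  let ?deg = "\<lambda>u. card (neighborhood u)"
  have reg: "?deg u = ?deg v" if "u \<rightarrow> v" for u v
  proof -
    \<comment> \<open>Adjacent vertices have the same closed neighbourhood by transitivity.\<close>
    have "insert u (neighborhood u) = insert v (neighborhood v)"
      using that trans adj_sym by blast
    moreover have "u \<notin> neighborhood u" "v \<notin> neighborhood v" by (fact not_in_own_neighborhood)+
    ultimately show ?thesis by (metis card_insert_disjoint finite_neighborhood old.nat.inject)
  qed
  have nonadj: "num_walks G l u v = 0"
    if "u \<in> verts G" "v \<in> verts G" "u \<noteq> v" "(u, v) \<notin> arcs_ends G" for u v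
    using swr that by (simp add: strongly_walk_regular_def)
  have pow: "?deg u ^ l = nu + ?deg u * lam" if u: "u \<in> verts G" for u
  proof -
    have sub: "insert u (neighborhood u) \<subseteq> verts G" using u neighborhood_subset_verts by blast
    have "(\<Sum>v\<in>verts G. num_walks G l u v) = (\<Sum>v\<in>insert u (neighborhood u). num_walks G l u v)"
    proof (intro sum.mono_neutral_right ballI)
      fix v assume "v \<in> verts G - insert u (neighborhood u)"
      then show "num_walks G l u v = 0"
        by (intro nonadj) (use u in auto)
    qed (simp_all only: finite_verts sub)
    also have "\<dots> = num_walks G l u u + (\<Sum>v\<in>neighborhood u. num_walks G l u v)"
      using not_in_own_neighborhood by (subst sum.insert) auto
    also have "\<dots> = nu + (\<Sum>v\<in>neighborhood u. lam)"
      using swr u adj_in_verts by (intro arg_cong2[where f = "(+)"] sum.cong)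
        (auto simp: strongly_walk_regular_def)
    finally show ?thesis using sum_num_walks_regular[OF reg u] by simp
  qed
  text \<open>This equation in the degree \<open>d\<close> has at most one positive solution because \<open>d ^ (l - 1)\<close>
    increases with \<open>d\<close> while \<open>nu / d + lam\<close> decreases.\<close>
  have le: "?deg u \<le> ?deg v" if u: "u \<in> verts G" and v: "v \<in> verts G" for u v
  proof (rule ccontr)
    assume "\<not> ?deg u \<le> ?deg v"
    then have less: "?deg v < ?deg u" by simp
    \<comment> \<open>Degree 0 would turn the equation into \<open>0 = nu\<close>.\<close>
    have pos: "0 < ?deg v" using pow[OF v] \<open>0 < nu\<close> \<open>1 < l\<close> by (cases "?deg v") auto
    have "?deg v * ?deg u ^ l = ?deg v * nu + ?deg v * ?deg u * lam"
      using pow[OF u] by (simp add: algebra_simps)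
    also have "\<dots> \<le> ?deg u * nu + ?deg v * ?deg u * lam"
      using less by simp
    also have "\<dots> = ?deg u * ?deg v ^ l"
      using pow[OF v] by (simp add: algebra_simps)
    finally have "?deg v * ?deg u * ?deg u ^ (l - 1) \<le> ?deg v * ?deg u * ?deg v ^ (l - 1)"
      using \<open>1 < l\<close> by (simp add: power_eq_if mult_ac)
    then have "?deg u ^ (l - 1) \<le> ?deg v ^ (l - 1)"
      using pos less by simp
    moreover have "?deg v ^ (l - 1) < ?deg u ^ (l - 1)"
      using less \<open>1 < l\<close> by (intro power_strict_mono) auto
    ultimately show False by linarith
  qed
  show ?thesis
  \<comment> \<open>The common degree is read off some vertex \<open>r\<close>; without vertices any
    value serves.\<close>
  proof (cases "verts G = {}")
    case True
    then show ?thesis by (intro disjoint_union_complete_graphs[OF trans]) auto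
  next
    case False
    then obtain r where "r \<in> verts G" by blast
    then show ?thesis
      using le by (intro disjoint_union_complete_graphs[OF trans, where d = "?deg r"]) (auto intro: antisym)
  qed
qed

end

theorem proposition5p1:
  fixes G :: "('a, 'b) pre_digraph" and l lam nu :: nat
  assumes "l > 1"
    and "graph G"
    and "undirected_edges G \<noteq> {}"
    and "strongly_walk_regular l lam 0 nu G"
  shows "disjoint_union_of_complete_graphs_same_order G \<or>
    (odd l \<and> disjoint_union_of_complete_bipartite_graphs_same_size_and_isolated_vertices G)"
proof -
  interpret graph G by fact
  note swr = assms(4)
  have closed_walks: "num_walks G l u u = nu" if "u \<in> verts G" for u
    using swr that by (simp add: strongly_walk_regular_def)
  have adj: "u \<rightarrow>\<^bsub>G\<^esub> v" if "u \<in> verts G" "v \<in> verts G" "0 < num_walks G l u v" "u \<noteq> v" for u v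
    using swr that by (force simp: strongly_walk_regular_def)
  obtain x y where xy: "x \<rightarrow>\<^bsub>G\<^esub> y" using assms(3) by (auto simp: undirected_edges_def)
  show ?thesis
  proof (cases "even l")
    case True
    then have walk: "0 < num_walks G l u v" if "u \<rightarrow>\<^bsub>G\<^esub> a" "a \<rightarrow>\<^bsub>G\<^esub> v" for u a v
      using num_walks_even_pos that assms(1) by simp
    \<comment> \<open>Going back and forth along the edge from \<open>x\<close> to \<open>y\<close>
      is a closed walk of even length.\<close>
    have "0 < nu"
      using walk[OF xy adj_sym[OF xy]] closed_walks adj_in_verts[OF xy] by simp
    moreover have "u \<rightarrow>\<^bsub>G\<^esub> w" if "u \<rightarrow>\<^bsub>G\<^esub> v" "v \<rightarrow>\<^bsub>G\<^esub> w" "u \<noteq> w" for u v w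
      using adj walk that adj_in_verts by metis
    ultimately show ?thesis
      using walk_regular_complete_graphs[OF swr assms(1)] by blast
  next
    case False
    then have "3 \<le> l" using assms(1) by presburger
    obtain j where l: "l = 2 * j + 1" using False by (rule oddE)
    have walk: "0 < num_walks G l u v" if "u \<rightarrow>\<^bsub>G\<^esub> a" "a \<rightarrow>\<^bsub>G\<^esub> b" "b \<rightarrow>\<^bsub>G\<^esub> v" for u a b v
      using num_walks_odd_pos[OF False \<open>3 \<le> l\<close>] that by blast
    have closed: "\<forall>u a b v. u \<rightarrow>\<^bsub>G\<^esub> a \<and> a \<rightarrow>\<^bsub>G\<^esub> b \<and> b \<rightarrow>\<^bsub>G\<^esub> v \<and> u \<noteq> v \<longrightarrow> u \<rightarrow>\<^bsub>G\<^esub> v"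
      using adj walk adj_in_verts by metis
    show ?thesis
    proof (cases "\<exists>u a b. u \<rightarrow>\<^bsub>G\<^esub> a \<and> a \<rightarrow>\<^bsub>G\<^esub> b \<and> b \<rightarrow>\<^bsub>G\<^esub> u")
      case True
      then have "0 < nu" using walk closed_walks adj_in_verts by metis
      \<comment> \<open>Positive \<open>nu\<close> gives each vertex a closed walk of odd length
        \<open>l\<close>; outside triangles this would yield a loop.\<close>
      then have triangle: "\<exists>a b. u \<rightarrow>\<^bsub>G\<^esub> a \<and> a \<rightarrow>\<^bsub>G\<^esub> b \<and> b \<rightarrow>\<^bsub>G\<^esub> u" if "u \<in> verts G" for u
        using odd_walk_to_triangle_free_vertex[OF closed, of u u j] that closed_walks
          adj_not_same l by metis
      have "u \<rightarrow>\<^bsub>G\<^esub> w" if "u \<rightarrow>\<^bsub>G\<^esub> v" "v \<rightarrow>\<^bsub>G\<^esub> w" "u \<noteq> w" for u v w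
        using triangle[OF adj_in_verts(1)[OF that(2)]] adj_trans_of_triangles[OF closed _ _ _ that]
        by blast
      then show ?thesis
        using walk_regular_complete_graphs[OF swr assms(1) \<open>0 < nu\<close>] by blast
    next
      case no_triangle: False
      have closed': "\<forall>u a b v. u \<rightarrow>\<^bsub>G\<^esub> a \<and> a \<rightarrow>\<^bsub>G\<^esub> b \<and> b \<rightarrow>\<^bsub>G\<^esub> v \<longrightarrow> u \<rightarrow>\<^bsub>G\<^esub> v"
        using closed no_triangle by metis
      have lam: "(card (neighborhood u) * card (neighborhood v)) ^ j = lam" if "u \<rightarrow>\<^bsub>G\<^esub> v" for u v
        using num_walks_odd_complete_bipartite[OF closed' that, of j] swr that adj_in_verts[OF that] l
        by (simp add: strongly_walk_regular_def)
      \<comment> \<open>As \<open>j\<close> is positive, j-th powers can be cancelled; the edge from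
        \<open>x\<close> to \<open>y\<close> supplies the common size.\<close>
      have "0 < j" using l assms(1) by simp
      then have "card (neighborhood u) * card (neighborhood v) =
          card (neighborhood x) * card (neighborhood y)" if "u \<rightarrow>\<^bsub>G\<^esub> v" for u v
        using power_eq_imp_eq_base[of _ j] lam[OF that] lam[OF xy] by (metis le0)
      then show ?thesis
        using disjoint_union_complete_bipartite_graphs[OF closed'] False by blast
    qed
  qed
qed

end
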